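(* Let $n\ge 5$ be an odd integer, and let $t\ge 1$ and $s\ge 1$ be integers. Then every one point union for paths $P_s^t(t\cdot s, G_n)$ of the Goldberg Snark graph $G_n$ is a Cordial graph.
   Context: **Goldberg Snark $G_n$.** For an odd integer $n\ge 5$, $G_n$ is the simple undirected cubic graph with the $8n$ vertices $v_{i,j}$ ($1\le i\le n$, $1\le j\le 8$) and the following $12n$ edges, where the first index is read cyclically modulo $n$ (so $v_{n+1,j}=v_{1,j}$). For every $1\le i\le n$: - inside the $i$-th block: $v_{i,1}v_{i,3}$, $v_{i,2}v_{i,4}$, $v_{i,3}v_{i,5}$, $v_{i,5}v_{i,7}$, $v_{i,1}v_{i,6}$, $v_{i,3}v_{i,8}$, $v_{i,1}v_{i,2}$, $v_{i,4}v_{i,5}$, $v_{i,6}v_{i,7}$; - between consecutive blocks: $v_{i,8}v_{i+1,8}$, $v_{i,6}v_{i+1,7}$, $v_{i,4}v_{i+1,2}$. **One point union of paths.** $P_s^t$ is the graph obtained from the star $K_{1,t}$ by replacing each edge by a path of length $s$ (with $s+1$ vertices). Thus it consists of $t$ paths of length $s$ sharing one common end vertex, the central vertex $v_0$, and it has $ts$ non-central vertices. **One point union for paths of a graph.** $P_s^t(t\cdot s,G)$ denotes a graph obtained from $P_s^t$ by replacing each of the $ts$ non-central vertices by a copy of $G$ (the copies being disjoint). Each edge of $P_s^t$ between two non-central vertices becomes exactly one edge joining a vertex of one of the corresponding copies to a vertex of the other, and each edge of $P_s^t$ at $v_0$ becomes exactly one edge joining $v_0$ to a vertex of the corresponding copy.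 (So it has $ts|V(G)|+1$ vertices and $ts|E(G)|+ts$ edges.) **Cordial graph.** Let $G=(V,E)$ be a finite simple graph. A vertex labeling $f:V(G)\to\{0,1\}$ induces the edge labeling $f^*:E(G)\to\{0,1\}$, $f^*(uv)=|f(u)-f(v)|$. For $i\in\{0,1\}$ let $v_f(i)$ be the number of vertices $v$ with $f(v)=i$, and $e_f(i)$ the number of edges $e$ with $f^*(e)=i$. Then $f$ is a Cordial labeling of $G$ if $|v_f(0)-v_f(1)|\le 1$ and $|e_f(0)-e_f(1)|\le 1$. A graph is Cordial if it admits a Cordial labeling. *)

theory Defs
  imports Main "HOL-Library.Disjoint_Sets"
begin

record 'a ugraph =
  verts :: "'a set"
  edges :: "'a set set"

definition finite_simple_graph :: "'a ugraph \<Rightarrow> bool" where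
  "finite_simple_graph G \<longleftrightarrow> finite (verts G) \<and> (\<forall>e\<in>edges G. e \<subseteq> verts G \<and> card e = 2)"


subsection \<open>Goldberg snarks\<close>

definition cyc_suc :: "nat \<Rightarrow> nat \<Rightarrow> nat" where
  "cyc_suc n i = (if i = n then 1 else i + 1)"

text \<open>The pair \<open>(i, j)\<close> stands for the vertex \<open>v\<^sub>i\<^sub>,\<^sub>j\<close>; both indices start at 1.\<close>

definition goldberg :: "nat \<Rightarrow> (nat \<times> nat) ugraph" where
  "goldberg n =
    \<lparr> verts = {1..n} \<times> {1..8},
      edges = (\<Union>i\<in>{1..n}.
        {{(i,1), (i,3)}, {(i,2), (i,4)}, {(i,3), (i,5)},
         {(i,5), (i,7)}, {(i,1), (i,6)}, {(i,3), (i,8)},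
         {(i,1), (i,2)}, {(i,4), (i,5)}, {(i,6), (i,7)},
         {(i,8), (cyc_suc n i, 8)}, {(i,6), (cyc_suc n i, 7)}, {(i,4), (cyc_suc n i, 2)}}) \<rparr>"


subsection \<open>One point unions of paths, and one point unions for paths of a graph\<close>

text \<open>\<open>paths_union s t\<close> is \<open>P\<^sub>s\<^sup>t\<close>: \<open>None\<close> is the central vertex, and \<open>Some (i, j)\<close> is the vertex at
  distance \<open>j\<close> from it on the \<open>i\<close>-th path.\<close>

definition paths_union :: "nat \<Rightarrow> nat \<Rightarrow> (nat \<times> nat) option ugraph" where
  "paths_union s t =
    \<lparr> verts = insert None (Some ` ({1..t} \<times> {1..s})),
      edges = {{None, Some (i, 1)} | i. i \<in> {1..t}} \<union>
              {{Some (i, j), Some (i, j + 1)} | i j. i \<in> {1..t} \<and> j \<in> {1..<s}} \<rparr>"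

text \<open>The set of vertices that replaces the vertex \<open>x\<close> of \<open>P\<^sub>s\<^sup>t\<close>, where \<open>c p\<close> embeds the copy of
  \<open>G\<close> at the non-central vertex \<open>Some p\<close>.\<close>

definition part :: "'b \<Rightarrow> (nat \<times> nat \<Rightarrow> 'a \<Rightarrow> 'b) \<Rightarrow> 'a ugraph \<Rightarrow> (nat \<times> nat) option \<Rightarrow> 'b set" where
  "part v0 c G x = (case x of None \<Rightarrow> {v0} | Some p \<Rightarrow> c p ` verts G)"

text \<open>The graph \<open>P\<^sub>s\<^sup>t(t\<cdot>s, G)\<close> is not determined by \<open>s\<close>, \<open>t\<close> and \<open>G\<close>, as the end points of the
  joining edges are free; hence a predicate on the resulting graph \<open>H\<close>. For an edge \<open>e\<close> of
  \<open>P\<^sub>s\<^sup>t\<close>, \<open>link e\<close> is the single edge of \<open>H\<close> that it becomes. Different edges of \<open>P\<^sub>s\<^sup>t\<close> may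
  use different vertices of the same copy.\<close>

definition is_one_point_union_for_paths :: "nat \<Rightarrow> nat \<Rightarrow> 'a ugraph \<Rightarrow> 'b ugraph \<Rightarrow> bool" where
  "is_one_point_union_for_paths s t G H \<longleftrightarrow>
    (\<exists>v0 c link.
      (\<forall>p\<in>{1..t} \<times> {1..s}. inj_on (c p) (verts G)) \<and>
      disjoint_family_on (part v0 c G) (verts (paths_union s t)) \<and>
      (\<forall>x y. {x, y} \<in> edges (paths_union s t) \<longrightarrow>
        (\<exists>a\<in>part v0 c G x. \<exists>b\<in>part v0 c G y. link {x, y} = {a, b})) \<and>
      verts H = (\<Union>x\<in>verts (paths_union s t). part v0 c G x) \<and>
      edges H = (\<Union>p\<in>{1..t} \<times> {1..s}. {c p ` e | e. e \<in> edges G}) \<union>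
                link ` edges (paths_union s t))"


subsection \<open>Cordial graphs\<close>

text \<open>The induced edge labeling is \<open>f\<^sup>*(uv) = \<bar>f u - f v\<bar>\<close>; labels are integers so that the
  subtraction does not truncate.\<close>

definition edge_label :: "('a \<Rightarrow> int) \<Rightarrow> 'a set \<Rightarrow> int" where
  "edge_label f e = (THE k. \<exists>u v. e = {u, v} \<and> k = \<bar>f u - f v\<bar>)"

lemma edge_label_insert: "edge_label f {u, v} = \<bar>f u - f v\<bar>"
  unfolding edge_label_def
  by (rule the_equality) (auto simp: doubleton_eq_iff)

definition vertex_count :: "'a ugraph \<Rightarrow> ('a \<Rightarrow> int) \<Rightarrow> int \<Rightarrow> nat" where
  "vertex_count G f i = card {v \<in> verts G. f v = i}"

definition edge_count :: "'a ugraph \<Rightarrow> ('a \<Rightarrow> int) \<Rightarrow> int \<Rightarrow> nat" where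
  "edge_count G f i = card {e \<in> edges G. edge_label f e = i}"

definition cordial_labeling :: "'a ugraph \<Rightarrow> ('a \<Rightarrow> int) \<Rightarrow> bool" where
  "cordial_labeling G f \<longleftrightarrow>
    (\<forall>v\<in>verts G. f v \<in> {0, 1}) \<and>
    \<bar>int (vertex_count G f 0) - int (vertex_count G f 1)\<bar> \<le> 1 \<and>
    \<bar>int (edge_count G f 0) - int (edge_count G f 1)\<bar> \<le> 1"

definition cordial :: "'a ugraph \<Rightarrow> bool" where
  "cordial G \<longleftrightarrow> finite_simple_graph G \<and> (\<exists>f. cordial_labeling G f)"

end

(* Label every block of the Goldberg snark by 1 exactly on the positions 2, 6, 7, 8. This uses each
   label 4n times on the vertices, and since the labeling does not depend on the block, the induced
   labels can be read off the 12 types of edges: six types get 0 and six get 1.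

   Complementing the labels on one copy of G does not change the labels of the edges inside it, but
   flips the label of each edge that joins it to the rest. As the paths form a tree, choosing the
   copies to complement from the centre outwards realises any prescribed labels on the joining
   edges, in particular a balanced choice. *)

theory Submission
  imports Defs
begin

section \<open>Label counts as signed sums\<close>

text \<open>The weight \<open>1 - 2 * k x\<close> is 1 for label 0 and -1 for label 1. As a sum, the
  imbalance can be split over disjoint unions and reindexed along injections.\<close>

lemma count_diff_eq_sum:
  fixes k :: "'a \<Rightarrow> int"
  assumes "finite S" "\<And>x. x \<in> S \<Longrightarrow> k x \<in> {0, 1}"
  shows "int (card {x \<in> S. k x = 0}) - int (card {x \<in> S. k x = 1}) = (\<Sum>x\<in>S. 1 - 2 * k x)"
proof -
  have "(\<Sum>x\<in>S. 1 - 2 * k x) = (\<Sum>x\<in>S. of_bool (k x = 0) - of_bool (k x = 1))"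
    using assms(2) by (intro sum.cong) auto
  also have "\<dots> = int (card {x \<in> S. k x = 0}) - int (card {x \<in> S. k x = 1})"
    using assms(1) by (simp add: sum_subtractf sum_of_bool_eq Collect_conj_eq)
  finally show ?thesis ..
qed

lemma edge_label_of_bool:
  "edge_label (\<lambda>w. of_bool (P w)) {u, v} = of_bool (P u \<noteq> P v)"
  by (simp add: edge_label_insert)

lemma card_2_edge:
  assumes "finite_simple_graph G" "e \<in> edges G"
  obtains u v where "e = {u, v}" "u \<in> verts G" "v \<in> verts G" "u \<noteq> v"
proof -
  have "e \<subseteq> verts G" "card e = 2"
    using assms by (auto simp: finite_simple_graph_def)
  then show ?thesis
    using that unfolding card_2_iff by auto
qed

lemma finite_edges:
  assumes "finite_simple_graph G"
  shows "finite (edges G)"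
proof (rule finite_subset)
  show "edges G \<subseteq> Pow (verts G)" "finite (Pow (verts G))"
    using assms unfolding finite_simple_graph_def by auto
qed

lemma edge_label_range:
  assumes "finite_simple_graph G" "\<forall>v\<in>verts G. f v \<in> {0, 1}" "e \<in> edges G"
  shows "edge_label f e \<in> {0, 1}"
proof -
  obtain u v where "e = {u, v}" "u \<in> verts G" "v \<in> verts G"
    using card_2_edge[OF assms(1,3)] by blast
  moreover from this have "f u \<in> {0, 1}" "f v \<in> {0, 1}"
    using assms(2) by blast+
  ultimately show ?thesis
    by (auto simp: edge_label_insert)
qed

lemma vertex_count_diff:
  assumes "finite_simple_graph G" "\<forall>v\<in>verts G. f v \<in> {0, 1}"
  shows "int (vertex_count G f 0) - int (vertex_count G f 1) = (\<Sum>v\<in>verts G. 1 - 2 * f v)"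
  unfolding vertex_count_def using assms
  by (intro count_diff_eq_sum) (auto simp: finite_simple_graph_def)

lemma edge_count_diff:
  assumes "finite_simple_graph G" "\<forall>v\<in>verts G. f v \<in> {0, 1}"
  shows "int (edge_count G f 0) - int (edge_count G f 1) = (\<Sum>e\<in>edges G. 1 - 2 * edge_label f e)"
  unfolding edge_count_def using assms
  by (intro count_diff_eq_sum finite_edges edge_label_range)

text \<open>Marking \<open>card S div 2\<close> elements leaves the remainder of
  \<open>card S\<close> modulo 2 as the sum.\<close>

lemma ex_balanced_labeling:
  assumes "finite S"
  obtains d :: "'a \<Rightarrow> bool" where "\<bar>\<Sum>x\<in>S. 1 - 2 * of_bool (d x) :: int\<bar> \<le> 1"
proof -
  obtain T where T: "T \<subseteq> S" "card T = card S div 2"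
    using obtain_subset_with_card_n[of "card S div 2" S] div_le_dividend by metis
  have "(\<Sum>x\<in>S. of_bool (x \<in> T)) = int (card (S \<inter> {x. x \<in> T}))"
    using assms by (simp add: sum_of_bool_eq)
  also have "S \<inter> {x. x \<in> T} = T"
    using T by auto
  finally have "(\<Sum>x\<in>S. 1 - 2 * of_bool (x \<in> T) :: int) = int (card S) - 2 * int (card T)"
    unfolding sum_subtractf sum_distrib_left[symmetric] by simp
  then have "\<bar>\<Sum>x\<in>S. 1 - 2 * of_bool (x \<in> T) :: int\<bar> \<le> 1"
    using T(2) by linarith
  then show ?thesis
    by (rule that)
qed

subsection \<open>Goldberg snarks\<close>

text \<open>The triple \<open>(j, k, b)\<close> stands for the edges from \<open>v\<^sub>i\<^sub>,\<^sub>j\<close> to \<open>v\<^sub>i\<^sub>,\<^sub>k\<close>, or to \<open>v\<^sub>i\<^sub>+\<^sub>1\<^sub>,\<^sub>k\<close> if \<open>b\<close>.\<close>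

definition goldberg_types :: "(nat \<times> nat \<times> bool) set" where
  "goldberg_types =
    {(1,3,False), (2,4,False), (3,5,False), (5,7,False), (1,6,False), (3,8,False),
     (1,2,False), (4,5,False), (6,7,False), (8,8,True), (6,7,True), (4,2,True)}"

definition goldberg_edge :: "nat \<Rightarrow> nat \<times> nat \<times> nat \<times> bool \<Rightarrow> (nat \<times> nat) set" where
  "goldberg_edge n = (\<lambda>(i, j, k, b). {(i, j), (if b then cyc_suc n i else i, k)})"

lemma edges_goldberg: "edges (goldberg n) = goldberg_edge n ` ({1..n} \<times> goldberg_types)"
proof -
  have "goldberg_edge n ` ({1..n} \<times> goldberg_types) =
      (\<Union>i\<in>{1..n}. (\<lambda>x. goldberg_edge n (i, x)) ` goldberg_types)"
    by blast
  then show ?thesis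
    by (simp add: goldberg_types_def goldberg_edge_def goldberg_def)
qed

text \<open>With at least two blocks, \<open>cyc_suc n i\<close> differs from \<open>i\<close>, so
  the edges of type \<open>(8,8,True)\<close> are not loops.\<close>

lemma finite_simple_graph_goldberg:
  assumes "n \<ge> 2"
  shows "finite_simple_graph (goldberg n)"
proof -
  have s: "cyc_suc n i \<in> {1..n}" "cyc_suc n i \<noteq> i" if "i \<in> {1..n}" for i
    using that assms by (auto simp: cyc_suc_def)
  have "goldberg_edge n (i, x) \<subseteq> {1..n} \<times> {1..8} \<and> card (goldberg_edge n (i, x)) = 2"
    if "i \<in> {1..n}" "x \<in> goldberg_types" for i x
    using that(2) s[OF that(1)] that(1)
    by (auto simp: goldberg_types_def goldberg_edge_def card_insert_if)
  then show ?thesis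
    unfolding finite_simple_graph_def edges_goldberg
    by (auto simp: goldberg_def)
qed

text \<open>This lets sums over edges be computed type by type. With two blocks it would fail: each
  would succeed the other, and both edges of type \<open>(8,8,True)\<close> would coincide.\<close>

lemma inj_on_goldberg_edge:
  assumes "n \<ge> 3"
  shows "inj_on (goldberg_edge n) ({1..n} \<times> goldberg_types)"
proof (rule inj_onI)
  fix x y
  assume "x \<in> {1..n} \<times> goldberg_types" "y \<in> {1..n} \<times> goldberg_types"
    "goldberg_edge n x = goldberg_edge n y"
  then obtain i j k b i' j' k' b' where xy: "x = (i, j, k, b)" "y = (i', j', k', b')"
    and i: "i \<in> {1..n}" "i' \<in> {1..n}"
    and T: "(j, k, b) \<in> goldberg_types" "(j', k', b') \<in> goldberg_types"
    and eq: "goldberg_edge n (i, j, k, b) = goldberg_edge n (i', j', k', b')"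
    by (metis mem_Sigma_iff prod_cases4)
  have s: "cyc_suc n i \<noteq> i" "cyc_suc n i' \<noteq> i'" "\<not> (cyc_suc n i = i' \<and> cyc_suc n i' = i)"
    using i assms by (auto simp: cyc_suc_def split: if_splits)
  have eq': "{(i, j), (if b then cyc_suc n i else i, k)}
      = {(i', j'), (if b' then cyc_suc n i' else i', k')}"
    using eq by (simp add: goldberg_edge_def)
  then have "{j, k} = {j', k'}"
    by (auto simp: doubleton_eq_iff)
  \<comment> \<open>The positions of the ends determine the type up to two coincidences:
    \<open>(6,7,False)\<close> with \<open>(6,7,True)\<close>, and \<open>(2,4,False)\<close> with
    \<open>(4,2,True)\<close>, where the order is reversed. The block indices must separate
    these.\<close>
  then have jk: "j = j' \<and> k = k' \<and> (b = b' \<or> j \<noteq> k) \<or> j = k' \<and> k = j' \<and> j \<noteq> k \<and> b \<noteq> b'"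
    using T unfolding goldberg_types_def
    by (simp only: insert_iff empty_iff prod.inject) (elim disjE conjE; simp add: doubleton_eq_iff)
  then have "i = i' \<and> b = b'"
  proof (elim disjE conjE)
    assume "j = j'" "k = k'" "b = b'"
    then show ?thesis
      using eq' s by (cases b) (auto simp: doubleton_eq_iff)
  next
    assume "j = j'" "k = k'" "j \<noteq> k"
    then show ?thesis
      using eq' s by (cases b; cases b') (auto simp: doubleton_eq_iff)
  next
    assume "j = k'" "k = j'" "j \<noteq> k" "b \<noteq> b'"
    then show ?thesis
      using eq' s by (cases b; cases b') (auto simp: doubleton_eq_iff)
  qed
  with jk xy show "x = y"
    by blast
qed

definition goldberg_labeling :: "nat \<times> nat \<Rightarrow> int" where
  "goldberg_labeling = (\<lambda>(i, j). of_bool (j \<in> {2, 6, 7, 8}))"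

lemma goldberg_labeling_range: "goldberg_labeling v \<in> {0, 1}"
  by (simp add: goldberg_labeling_def split: prod.split)

lemma goldberg_vertices_balanced:
  "(\<Sum>v\<in>verts (goldberg n). 1 - 2 * goldberg_labeling v) = 0"
proof -
  have "{1..8::nat} = {1,2,3,4,5,6,7,8}"
    by auto
  then have "(\<Sum>j\<in>{1..8}. 1 - 2 * goldberg_labeling (i, j)) = 0" for i
    by (simp add: goldberg_labeling_def)
  then show ?thesis
    by (simp add: goldberg_def sum.cartesian_product' )
qed

text \<open>The induced label depends only on the type, so the block index drops out and each
  \<open>i\<close> contributes six terms 1 and six terms -1.\<close>

lemma goldberg_edges_balanced:
  assumes "n \<ge> 3"
  shows "(\<Sum>e\<in>edges (goldberg n). 1 - 2 * edge_label goldberg_labeling e) = 0"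
proof -
  have "(\<Sum>x\<in>goldberg_types. 1 - 2 * edge_label goldberg_labeling (goldberg_edge n (i, x))) = 0" for i
    unfolding goldberg_types_def
    by (simp add: goldberg_edge_def edge_label_insert goldberg_labeling_def)
  then show ?thesis
    unfolding edges_goldberg sum.reindex[OF inj_on_goldberg_edge[OF assms]]
    by (simp add: sum.cartesian_product')
qed

subsection \<open>One point unions for paths\<close>

text \<open>Treating the centre as position 0 of every path merges the two kinds of edges of
  \<open>paths_union\<close> into one indexed family.\<close>

definition path_node :: "nat \<Rightarrow> nat \<Rightarrow> (nat \<times> nat) option" where
  "path_node i j = (if j = 0 then None else Some (i, j))"

text \<open>The pair \<open>(i, j)\<close> indexes the edge from distance \<open>j\<close> to
  \<open>Suc j\<close>. For \<open>s = 0\<close> the edges at the centre would still be in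
  \<open>paths_union\<close>, but not in the image.\<close>

lemma edges_paths_union:
  assumes "s \<ge> 1"
  shows "edges (paths_union s t) =
    (\<lambda>(i, j). {path_node i j, path_node i (Suc j)}) ` ({1..t} \<times> {..<s})" (is "_ = ?e ` ?Q")
proof
  show "edges (paths_union s t) \<subseteq> ?e ` ?Q"
  proof
    fix e assume "e \<in> edges (paths_union s t)"
    then consider i where "i \<in> {1..t}" "e = {None, Some (i, 1)}"
      | i j where "i \<in> {1..t}" "j \<in> {1..<s}" "e = {Some (i, j), Some (i, j + 1)}"
      unfolding paths_union_def by auto
    then show "e \<in> ?e ` ?Q"
    proof cases
      case 1
      then show ?thesis
        using assms by (intro image_eqI[of _ _ "(i, 0)"]) (auto simp: path_node_def)
    next
      case 2
      then show ?thesis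
        by (intro image_eqI[of _ _ "(i, j)"]) (auto simp: path_node_def)
    qed
  qed
next
  have "?e (i, j) \<in> edges (paths_union s t)" if "i \<in> {1..t}" "j < s" for i j
    using that by (cases j) (auto simp: paths_union_def path_node_def)
  then show "?e ` ?Q \<subseteq> edges (paths_union s t)"
    by auto
qed

lemma inj_path_edge: "inj (\<lambda>(i, j). {path_node i j, path_node i (Suc j)})"
proof (rule injI, clarify)
  fix i j i' j' :: nat
  assume "{path_node i j, path_node i (Suc j)} = {path_node i' j', path_node i' (Suc j')}"
  then show "i = i' \<and> j = j'"
    by (cases j; cases j') (auto simp: path_node_def doubleton_eq_iff)
qed

text \<open>Nothing here is specific to snarks: since both sums over \<open>G\<close> vanish, every
  copy contributes 0, complemented or not. Only the central vertex and the joining edges affect the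
  balance.\<close>

theorem cordial_one_point_union_for_paths:
  fixes G :: "'a ugraph" and H :: "'b ugraph" and f :: "'a \<Rightarrow> int"
  assumes G: "finite_simple_graph G"
    and f: "\<And>v. v \<in> verts G \<Longrightarrow> f v \<in> {0, 1}"
    and fv: "(\<Sum>v\<in>verts G. 1 - 2 * f v) = 0"
    and fe: "(\<Sum>e\<in>edges G. 1 - 2 * edge_label f e) = 0"
    and s: "s \<ge> 1"
    and H: "is_one_point_union_for_paths s t G H"
  shows "cordial H"
proof -
  define P where "P = {1..t} \<times> {1..s}"
  define Q where "Q = {1..t} \<times> {..<s}"
  have fin: "finite P" "finite Q"
    by (auto simp: P_def Q_def)
  have V: "verts (paths_union s t) = insert None (Some ` P)"
    by (simp add: paths_union_def P_def)
  obtain v0 c link where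
        inj: "\<And>p. p \<in> P \<Longrightarrow> inj_on (c p) (verts G)"
    and disj: "disjoint_family_on (part v0 c G) (insert None (Some ` P))"
    and link: "\<And>x y. {x, y} \<in> edges (paths_union s t) \<Longrightarrow>
        \<exists>a\<in>part v0 c G x. \<exists>b\<in>part v0 c G y. link {x, y} = {a, b}"
    and vH: "verts H = (\<Union>x\<in>insert None (Some ` P). part v0 c G x)"
    and eH: "edges H = (\<Union>p\<in>P. {c p ` e | e. e \<in> edges G}) \<union> link ` edges (paths_union s t)"
    using H unfolding is_one_point_union_for_paths_def P_def[symmetric] V
    by (elim exE conjE) (rule that; (assumption | blast))
  have node: "path_node i j \<in> insert None (Some ` P)"
      "path_node i (Suc j) \<in> insert None (Some ` P)" if "(i, j) \<in> Q" for i j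
    using that by (auto simp: path_node_def P_def Q_def)

  have "\<exists>a b. a \<in> part v0 c G (path_node i j) \<and> b \<in> part v0 c G (path_node i (Suc j)) \<and>
      link {path_node i j, path_node i (Suc j)} = {a, b}" if "(i, j) \<in> Q" for i j
  proof -
    have "{path_node i j, path_node i (Suc j)} \<in> edges (paths_union s t)"
      unfolding edges_paths_union[OF s] using that by (auto simp: Q_def)
    from link[OF this] show ?thesis
      by blast
  qed
  \<comment> \<open>The joining edges get oriented: \<open>a i j\<close> is the end nearer to the
    centre, \<open>b i j\<close> the farther one.\<close>
  then obtain a b where
        a: "\<And>i j. (i, j) \<in> Q \<Longrightarrow> a i j \<in> part v0 c G (path_node i j)"
    and b: "\<And>i j. (i, j) \<in> Q \<Longrightarrow> b i j \<in> part v0 c G (path_node i (Suc j))"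
    and ab: "\<And>i j. (i, j) \<in> Q \<Longrightarrow> link {path_node i j, path_node i (Suc j)} = {a i j, b i j}"
    by metis
  define L where "L = (\<lambda>(i, j). {a i j, b i j})"
  have links: "link ` edges (paths_union s t) = L ` Q"
    unfolding edges_paths_union[OF s] image_image Q_def[symmetric]
    using ab by (intro image_cong) (auto simp: L_def)

  \<comment> \<open>This is the projection of \<open>H\<close> onto the vertices of the path union,
    well defined as the parts are disjoint. It maps a joining edge to the edge it came from and an
    edge of a copy to a singleton, which tells all these edges apart.\<close>
  define idx where "idx w = (THE x. x \<in> insert None (Some ` P) \<and> w \<in> part v0 c G x)" for w
  have idx: "idx w = x" if "x \<in> insert None (Some ` P)" "w \<in> part v0 c G x" for x w
    unfolding idx_def using that disjoint_family_onD[OF disj] by (intro the_equality conjI) blast+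
  have idx_copy: "idx (c p v) = Some p" if "p \<in> P" "v \<in> verts G" for p v
    using that by (intro idx) (auto simp: part_def)
  have idx_v0: "idx v0 = None"
    by (intro idx) (auto simp: part_def)
  have idx_L: "idx ` L (i, j) = {path_node i j, path_node i (Suc j)}" if "(i, j) \<in> Q" for i j
    using idx[OF node(1) a] idx[OF node(2) b] that by (simp add: L_def)
  have idx_edge: "idx ` c p ` e = {Some p}" if p: "p \<in> P" and e: "e \<in> edges G" for p e
  proof -
    obtain u v where "e = {u, v}" "u \<in> verts G" "v \<in> verts G"
      using card_2_edge[OF G e] .
    then show ?thesis
      using idx_copy[OF p] by simp
  qed

  \<comment> \<open>The edges of \<open>H\<close> without repetition\<close>
  have edgesH: "edges H = (\<Union>p\<in>P. (`) (c p) ` edges G) \<union> L ` Q"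
    unfolding eH links by blast
  have inj_L: "inj_on L Q"
  proof (rule inj_onI)
    fix x y assume xy: "x \<in> Q" "y \<in> Q" "L x = L y"
    obtain i j i' j' where ij: "x = (i, j)" "y = (i', j')"
      by fastforce
    have "{path_node i j, path_node i (Suc j)} = {path_node i' j', path_node i' (Suc j')}"
      using xy idx_L[of i j] idx_L[of i' j'] ij by simp
    then show "x = y"
      using injD[OF inj_path_edge, of x y] ij by simp
  qed
  have inj_copy: "inj_on ((`) (c p)) (edges G)" if "p \<in> P" for p
    by (rule inj_on_subset[OF inj_on_image_Pow[OF inj[OF that]]])
      (use G in \<open>auto simp: finite_simple_graph_def\<close>)
  have L_copy: "L q \<noteq> c p ` e" if "q \<in> Q" "p \<in> P" "e \<in> edges G" for p q e
  proof
    assume "L q = c p ` e"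
    moreover obtain i j where "q = (i, j)"
      by fastforce
    ultimately have "{path_node i j, path_node i (Suc j)} = {Some p}"
      using that idx_L[of i j] idx_edge[of p e] by simp
    then show False
      by (auto simp: path_node_def doubleton_eq_iff split: if_splits)
  qed

  \<comment> \<open>Simplicity of \<open>H\<close>\<close>
  have vertsH: "verts H = insert v0 (\<Union>p\<in>P. c p ` verts G)"
    unfolding vH by (auto simp: part_def)
  have in_H: "part v0 c G x \<subseteq> verts H" if "x \<in> insert None (Some ` P)" for x
    using that vH by blast
  have fsH: "finite_simple_graph H"
  proof -
    have "finite (verts H)"
      unfolding vertsH using fin G by (auto simp: finite_simple_graph_def)
    moreover have "c p ` e \<subseteq> verts H \<and> card (c p ` e) = 2" if "p \<in> P" "e \<in> edges G" for p e
    proof -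
      have e: "e \<subseteq> verts G" "card e = 2"
        using G that by (auto simp: finite_simple_graph_def)
      then show ?thesis
        using card_image[OF inj_on_subset[OF inj[OF that(1)] e(1)]] that(1) by (auto simp: vertsH)
    qed
    moreover have "L q \<subseteq> verts H \<and> card (L q) = 2" if "q \<in> Q" for q
    proof -
      obtain i j where q: "q = (i, j)"
        by fastforce
      with that have ij: "(i, j) \<in> Q"
        by simp
      have "idx (a i j) \<noteq> idx (b i j)"
        using idx[OF node(1) a] idx[OF node(2) b] ij by (simp add: path_node_def)
      then have "a i j \<noteq> b i j"
        by auto
      then show ?thesis
        using subsetD[OF in_H[OF node(1)] a] subsetD[OF in_H[OF node(2)] b] ij by (simp add: L_def q)
    qed
    ultimately show ?thesis
      unfolding finite_simple_graph_def edgesH by blast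
  qed

  \<comment> \<open>The labeling of \<open>H\<close>\<close>
  \<comment> \<open>These are the labels prescribed for the joining edges.\<close>
  obtain d :: "nat \<times> nat \<Rightarrow> bool" where d: "\<bar>\<Sum>q\<in>Q. 1 - 2 * of_bool (d q) :: int\<bar> \<le> 1"
    using ex_balanced_labeling[OF fin(2)] .
  \<comment> \<open>This is the labeling before any complementing: \<open>f\<close> carried over to
    each copy, and 0 at the centre.\<close>
  define g where
    "g w = (case idx w of None \<Rightarrow> False | Some p \<Rightarrow> f (inv_into (verts G) (c p) w) = 1)" for w
  text \<open>Whether the copy at distance \<open>j\<close> on path \<open>i\<close> is complemented.\<close>
  define B where "B i = rec_nat False (\<lambda>j r. d (i, j) \<noteq> (g (a i j) \<noteq> (g (b i j) \<noteq> r)))" for i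
  define C where "C x = (case x of None \<Rightarrow> False | Some (i, j) \<Rightarrow> B i j)" for x
  define h where "h w = (g w \<noteq> C (idx w))" for w
  define F :: "'b \<Rightarrow> int" where "F w = of_bool (h w)" for w
  \<comment> \<open>At \<open>j = 0\<close> this holds because the recursion for every path starts
    with \<open>False\<close>: all paths agree that the centre is not flipped.\<close>
  have C_node: "C (path_node i j) = B i j" for i j
    by (simp add: C_def path_node_def B_def)
  have h_copy: "h (c p v) = ((f v = 1) \<noteq> C (Some p))" if "p \<in> P" "v \<in> verts G" for p v
    using that inj by (simp add: h_def g_def idx_copy)
  have label_copy: "edge_label F (c p ` e) = edge_label f e" if p: "p \<in> P" and e: "e \<in> edges G" for p e
  proof -
    obtain u v where "e = {u, v}" "u \<in> verts G" "v \<in> verts G"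
      using card_2_edge[OF G e] .
    then show ?thesis
      using f[of u] f[of v] p by (auto simp: edge_label_insert F_def h_copy)
  qed
  have label_L: "edge_label F (L (i, j)) = of_bool (d (i, j))" if "(i, j) \<in> Q" for i j
  proof -
    \<comment> \<open>With \<open>\<noteq>\<close> read as exclusive or, the recursion is the
      equation \<open>h (a i j) \<noteq> h (b i j)\<close> equals \<open>d (i, j)\<close>, solved
      for the flip of the farther copy.\<close>
    have "B i (Suc j) = (d (i, j) \<noteq> (g (a i j) \<noteq> (g (b i j) \<noteq> B i j)))"
      by (simp add: B_def)
    then have "(h (a i j) \<noteq> h (b i j)) = d (i, j)"
      using idx[OF node(1) a] idx[OF node(2) b] that by (auto simp: h_def C_node)
    then show ?thesis
      unfolding L_def F_def by (simp only: case_prod_conv edge_label_of_bool)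
  qed

  \<comment> \<open>Balance of the vertex labels\<close>
  have F01: "\<forall>v\<in>verts H. F v \<in> {0, 1}"
    by (simp add: F_def)
  have copy_sum: "(\<Sum>w\<in>c p ` verts G. 1 - 2 * F w) = 0" if "p \<in> P" for p
  proof -
    have "(\<Sum>w\<in>c p ` verts G. 1 - 2 * F w) = (\<Sum>v\<in>verts G. 1 - 2 * F (c p v))"
      by (simp add: sum.reindex[OF inj[OF that]])
    \<comment> \<open>Complementing a copy negates all its weights, and a sum equal to 0 survives
      this.\<close>
    also have "\<dots> = (\<Sum>v\<in>verts G. (if C (Some p) then -1 else 1) * (1 - 2 * f v))"
      using f by (intro sum.cong refl) (force simp: F_def h_copy that)
    also have "\<dots> = 0"
      unfolding sum_distrib_left[symmetric] fv by simp
    finally show ?thesis .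
  qed
  have "(\<Sum>v\<in>verts H. 1 - 2 * F v) = (1 - 2 * F v0) + (\<Sum>w\<in>(\<Union>p\<in>P. c p ` verts G). 1 - 2 * F w)"
    unfolding vertsH
  proof (rule sum.insert)
    show "finite (\<Union>p\<in>P. c p ` verts G)"
      using fin G by (auto simp: finite_simple_graph_def)
    show "v0 \<notin> (\<Union>p\<in>P. c p ` verts G)"
      using idx_copy idx_v0 by force
  qed
  also have "(\<Sum>w\<in>(\<Union>p\<in>P. c p ` verts G). 1 - 2 * F w) = (\<Sum>p\<in>P. \<Sum>w\<in>c p ` verts G. 1 - 2 * F w)"
  proof (rule sum.UNION_disjoint)
    show "\<forall>p\<in>P. \<forall>q\<in>P. p \<noteq> q \<longrightarrow> c p ` verts G \<inter> c q ` verts G = {}"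
    proof (intro ballI impI)
      fix p q assume pq: "p \<in> P" "q \<in> P" "p \<noteq> q"
      have "idx w = Some p" if "w \<in> c p ` verts G" for w
        using that idx_copy[OF pq(1)] by auto
      moreover have "idx w = Some q" if "w \<in> c q ` verts G" for w
        using that idx_copy[OF pq(2)] by auto
      ultimately show "c p ` verts G \<inter> c q ` verts G = {}"
        using pq(3) by force
    qed
  qed (use fin G in \<open>auto simp: finite_simple_graph_def\<close>)
  \<comment> \<open>All copies cancel, leaving the weight of \<open>v0\<close>, which is 1 or
    -1.\<close>
  finally have vdiff: "\<bar>\<Sum>v\<in>verts H. 1 - 2 * F v\<bar> \<le> 1"
    by (simp add: copy_sum) (simp add: F_def)

  \<comment> \<open>Balance of the edge labels\<close>
  have "(\<Sum>e\<in>(\<Union>p\<in>P. (`) (c p) ` edges G). 1 - 2 * edge_label F e) =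
      (\<Sum>p\<in>P. \<Sum>e\<in>(`) (c p) ` edges G. 1 - 2 * edge_label F e)"
  proof (rule sum.UNION_disjoint)
    show "\<forall>p\<in>P. \<forall>q\<in>P. p \<noteq> q \<longrightarrow> (`) (c p) ` edges G \<inter> (`) (c q) ` edges G = {}"
    proof (intro ballI impI)
      fix p q assume pq: "p \<in> P" "q \<in> P" "p \<noteq> q"
      have "idx ` e = {Some p}" if "e \<in> (`) (c p) ` edges G" for e
        using that by (elim imageE) (simp only: idx_edge[OF pq(1)])
      moreover have "idx ` e = {Some q}" if "e \<in> (`) (c q) ` edges G" for e
        using that by (elim imageE) (simp only: idx_edge[OF pq(2)])
      ultimately show "(`) (c p) ` edges G \<inter> (`) (c q) ` edges G = {}"
        using pq(3) by (metis disjoint_iff option.inject singleton_inject)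
    qed
  qed (use fin finite_edges[OF G] in auto)
  also have "\<dots> = (\<Sum>p\<in>P. \<Sum>e\<in>edges G. 1 - 2 * edge_label f e)"
  proof (rule sum.cong[OF refl])
    fix p assume p: "p \<in> P"
    show "(\<Sum>e\<in>(`) (c p) ` edges G. 1 - 2 * edge_label F e) = (\<Sum>e\<in>edges G. 1 - 2 * edge_label f e)"
      unfolding sum.reindex[OF inj_copy[OF p]] o_def
      by (rule sum.cong[OF refl]) (simp only: label_copy[OF p])
  qed
  finally have copies: "(\<Sum>e\<in>(\<Union>p\<in>P. (`) (c p) ` edges G). 1 - 2 * edge_label F e) = 0"
    using fe by simp
  have label_L': "edge_label F (L q) = of_bool (d q)" if "q \<in> Q" for q
    using label_L[of "fst q" "snd q"] that by simp
  have "(\<Sum>e\<in>L ` Q. 1 - 2 * edge_label F e) = (\<Sum>q\<in>Q. 1 - 2 * edge_label F (L q))"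
    by (simp add: sum.reindex[OF inj_L])
  also have "\<dots> = (\<Sum>q\<in>Q. 1 - 2 * of_bool (d q))"
    by (intro sum.cong refl) (simp only: label_L')
  finally have links: "(\<Sum>e\<in>L ` Q. 1 - 2 * edge_label F e) = (\<Sum>q\<in>Q. 1 - 2 * of_bool (d q))" .
  have "(\<Sum>e\<in>edges H. 1 - 2 * edge_label F e) =
      (\<Sum>e\<in>(\<Union>p\<in>P. (`) (c p) ` edges G). 1 - 2 * edge_label F e) +
      (\<Sum>e\<in>L ` Q. 1 - 2 * edge_label F e)"
    unfolding edgesH
  proof (rule sum.union_disjoint)
    show "(\<Union>p\<in>P. (`) (c p) ` edges G) \<inter> L ` Q = {}"
      using L_copy by blast
  qed (use fin finite_edges[OF G] in auto)
  \<comment> \<open>The copies add 0, so the total is the sum over the joining edges, bounded by the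
    choice of \<open>d\<close>.\<close>
  then have ediff: "\<bar>\<Sum>e\<in>edges H. 1 - 2 * edge_label F e\<bar> \<le> 1"
    using d by (simp only: copies links add_0)

  have "cordial_labeling H F"
    unfolding cordial_labeling_def vertex_count_diff[OF fsH F01] edge_count_diff[OF fsH F01]
    using F01 vdiff ediff by blast
  with fsH show ?thesis
    unfolding cordial_def by blast
qed

theorem theorem4:
  fixes n s t :: nat and H :: "'b ugraph"
  assumes "n \<ge> 5" and "odd n" and "t \<ge> 1" and "s \<ge> 1"
    and "is_one_point_union_for_paths s t (goldberg n) H"
  shows "cordial H"
  using finite_simple_graph_goldberg goldberg_labeling_range goldberg_vertices_balanced
    goldberg_edges_balanced assms(4,5)
  by (rule cordial_one_point_union_for_paths) (use assms(1) in auto)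

end
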